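(* Let $P$ be a finite set of atomic propositions, $T\in\mathbb{N}$, $\mathbb{T}=\{0,1,\dots,T\}$, and let $x:\mathbb{T}\to 2^P$ be a discrete-time signal. For every MTL formula $\varphi$ (built from the grammar given in the context, with closed time intervals $[a,b]$, $a,b\in\mathbb{N}$, $0\le a\le b$) and every $i\in\mathbb{T}$, the LTI-filtering value of $\varphi$ at $i$ equals $1$ if and only if $(x,i)\models_C\varphi$ in the classical semantics, i.e. $(x,i)\models_L\varphi \iff (x,i)\models_C\varphi$.
   Context: For $p\in P$, $x_p:\mathbb{T}\to\{0,1\}$ is the projection, $x_p[i]=1$ iff $p\in x[i]$. Formulas: $\varphi ::= p \mid \neg\varphi \mid \varphi_1\vee\varphi_2 \mid \varphi_1 U_I\varphi_2 \mid \varphi_1 S_I \varphi_2 \mid F_I\varphi\mid G_I\varphi\mid P_I\varphi\mid H_I\varphi$ (also $\wedge$, with $\varphi\wedge\psi=\neg(\neg\varphi\vee\neg\psi)$). Classical semantics $\models_C$: $(x,i)\models p$ iff $x_p[i]=1$; $\neg,\vee$ as usual; $(x,i)\models \varphi U_I\psi$ iff there is $j\in(i+I)\cap\mathbb{T}$ with $(x,j)\models\psi$ and $(x,k)\models\varphi$ for all integers $k$ with $i<k<j$; $(x,i)\models\varphi S_I\psi$ iff there is $j\in(i-I)\cap\mathbb{T}$ with $(x,j)\models\psi$ and $(x,k)\models\varphi$ for all integers $k$ with $j<k<i$; $(x,i)\models F_I\varphi$ iff $\exists j\in(i+I)\cap\mathbb{T}$ with $(x,j)\models\varphi$; $G_I\varphi$: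 for all $j\in(i+I)\cap\mathbb{T}$; $P_I\varphi$: $\exists j\in(i-I)\cap\mathbb{T}$; $H_I\varphi$: for all $j\in(i-I)\cap\mathbb{T}$. LTI-filtering semantics $\models_L$ (values in $\{0,1\}$, interpreting addition and multiplication in the max–min dioid): let $\delta$ be the Kronecker delta ($\delta(0)=1$, $\delta(n)=0$ otherwise), and for a closed integer interval $I$ (possibly empty, $[a,b]$ with $b<a$ being empty) define unnormalized windows $w^+_I[t]=\max_{k\in I}\delta(t+k)$ and $w^-_I[t]=\max_{k\in I}\delta(t-k)$ (identically $0$ if $I=\emptyset$). Then: $(x,i)\models_L p = x_p[i]$; $(x,i)\models_L\neg\varphi = 1-((x,i)\models_L\varphi)$; $(x,i)\models_L\varphi\vee\psi=\max$ of the two values; $(x,i)\models_L F_I\varphi=\max_{j\in\mathbb{T}}\min((x,j)\models_L\varphi,\,w^+_I[i-j])$; $(x,i)\models_L G_I\varphi = 1-((x,i)\models_L F_I\neg\varphi)$; $(x,i)\models_L P_I\varphi=\max_{j\in\mathbb{T}}\min((x,j)\models_L\varphi,\,w^-_I[i-j])$; $(x,i)\models_L H_I\varphi=1-((x,i)\models_L P_I\neg\varphi)$; $(x,i)\models_L\varphi U_I\psi=\max_{j\in I}\min((x,i)\models_L G_{[1,j-1]}\varphi,\ (x,i)\models_L F_{[j,j]}\psi)$; $(x,i)\models_L\varphi S_I\psi=\max_{j\in I}\min((x,i)\models_L H_{[1,j-1]}\varphi,\ (x,i)\models_L P_{[j,j]}\psi)$. "$(x,i)\models_L\varphi$" means this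 value is $1$. *)

theory Defs
  imports Complex_Main "HOL-Library.FuncSet"
begin

text \<open>
  The two integers carried by a temporal operator are the endpoints of its closed interval
  \<^term>\<open>{a..b}\<close>. Integer endpoints make the intervals \<open>[1, j - 1]\<close> of the filtering semantics
  of \<open>U\<close> and \<open>S\<close> expressible also for \<open>j = 0\<close>, where the interval is empty; the condition
  \<open>0 \<le> a \<le> b\<close> of the grammar is imposed by \<open>mtl_formula\<close>.
\<close>

datatype 'p mtl =
    Atom 'p
  | Not "'p mtl"
  | Or "'p mtl" "'p mtl"
  | Until "'p mtl" int int "'p mtl"
  | Since "'p mtl" int int "'p mtl"
  | Finally int int "'p mtl"
  | Globally int int "'p mtl"
  | Past int int "'p mtl"
  | Historically int int "'p mtl"

abbreviation And :: "'p mtl \<Rightarrow> 'p mtl \<Rightarrow> 'p mtl" where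
  "And \<phi> \<psi> \<equiv> Not (Or (Not \<phi>) (Not \<psi>))"

primrec mtl_formula :: "'p set \<Rightarrow> 'p mtl \<Rightarrow> bool" where
  "mtl_formula P (Atom p) \<longleftrightarrow> p \<in> P"
| "mtl_formula P (Not \<phi>) \<longleftrightarrow> mtl_formula P \<phi>"
| "mtl_formula P (Or \<phi> \<psi>) \<longleftrightarrow> mtl_formula P \<phi> \<and> mtl_formula P \<psi>"
| "mtl_formula P (Until \<phi> a b \<psi>) \<longleftrightarrow>
     0 \<le> a \<and> a \<le> b \<and> mtl_formula P \<phi> \<and> mtl_formula P \<psi>"
| "mtl_formula P (Since \<phi> a b \<psi>) \<longleftrightarrow>
     0 \<le> a \<and> a \<le> b \<and> mtl_formula P \<phi> \<and> mtl_formula P \<psi>"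
| "mtl_formula P (Finally a b \<phi>) \<longleftrightarrow> 0 \<le> a \<and> a \<le> b \<and> mtl_formula P \<phi>"
| "mtl_formula P (Globally a b \<phi>) \<longleftrightarrow> 0 \<le> a \<and> a \<le> b \<and> mtl_formula P \<phi>"
| "mtl_formula P (Past a b \<phi>) \<longleftrightarrow> 0 \<le> a \<and> a \<le> b \<and> mtl_formula P \<phi>"
| "mtl_formula P (Historically a b \<phi>) \<longleftrightarrow> 0 \<le> a \<and> a \<le> b \<and> mtl_formula P \<phi>"

definition time :: "nat \<Rightarrow> int set" where
  "time T = {0..int T}"

definition proj :: "(int \<Rightarrow> 'p set) \<Rightarrow> 'p \<Rightarrow> int \<Rightarrow> nat" where
  "proj x p i = (if p \<in> x i then 1 else 0)"

primrec sat_C :: "nat \<Rightarrow> (int \<Rightarrow> 'p set) \<Rightarrow> 'p mtl \<Rightarrow> int \<Rightarrow> bool" where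
  "sat_C T x (Atom p) i \<longleftrightarrow> proj x p i = 1"
| "sat_C T x (Not \<phi>) i \<longleftrightarrow> \<not> sat_C T x \<phi> i"
| "sat_C T x (Or \<phi> \<psi>) i \<longleftrightarrow> sat_C T x \<phi> i \<or> sat_C T x \<psi> i"
| "sat_C T x (Until \<phi> a b \<psi>) i \<longleftrightarrow>
     (\<exists>j \<in> (\<lambda>k. i + k) ` {a..b} \<inter> time T.
        sat_C T x \<psi> j \<and> (\<forall>k. i < k \<and> k < j \<longrightarrow> sat_C T x \<phi> k))"
| "sat_C T x (Since \<phi> a b \<psi>) i \<longleftrightarrow>
     (\<exists>j \<in> (\<lambda>k. i - k) ` {a..b} \<inter> time T.
        sat_C T x \<psi> j \<and> (\<forall>k. j < k \<and> k < i \<longrightarrow> sat_C T x \<phi> k))"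
| "sat_C T x (Finally a b \<phi>) i \<longleftrightarrow> (\<exists>j \<in> (\<lambda>k. i + k) ` {a..b} \<inter> time T. sat_C T x \<phi> j)"
| "sat_C T x (Globally a b \<phi>) i \<longleftrightarrow> (\<forall>j \<in> (\<lambda>k. i + k) ` {a..b} \<inter> time T. sat_C T x \<phi> j)"
| "sat_C T x (Past a b \<phi>) i \<longleftrightarrow> (\<exists>j \<in> (\<lambda>k. i - k) ` {a..b} \<inter> time T. sat_C T x \<phi> j)"
| "sat_C T x (Historically a b \<phi>) i \<longleftrightarrow> (\<forall>j \<in> (\<lambda>k. i - k) ` {a..b} \<inter> time T. sat_C T x \<phi> j)"

definition kdelta :: "int \<Rightarrow> nat" where
  "kdelta n = (if n = 0 then 1 else 0)"

text \<open>
  Maxima are written with \<open>SUP\<close> on \<^typ>\<open>nat\<close>, which is the maximum of a nonempty finite set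
  and \<open>0\<close>, the zero of the max--min dioid, on the empty set.
\<close>

definition window_plus :: "int \<Rightarrow> int \<Rightarrow> int \<Rightarrow> nat" where
  "window_plus a b t = (SUP k\<in>{a..b}. kdelta (t + k))"

definition window_minus :: "int \<Rightarrow> int \<Rightarrow> int \<Rightarrow> nat" where
  "window_minus a b t = (SUP k\<in>{a..b}. kdelta (t - k))"

text \<open>
  Termination measure for the filtering semantics, in which \<open>U\<close> and \<open>S\<close> are reduced to
  \<open>G\<close>, \<open>F\<close> and \<open>H\<close>, \<open>P\<close>, and \<open>G\<close>, \<open>H\<close> to \<open>F\<close>, \<open>P\<close> of a negation.
\<close>

primrec weight :: "'p mtl \<Rightarrow> nat" where
  "weight (Atom p) = 0"
| "weight (Not \<phi>) = weight \<phi> + 1"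
| "weight (Or \<phi> \<psi>) = weight \<phi> + weight \<psi> + 1"
| "weight (Until \<phi> a b \<psi>) = weight \<phi> + weight \<psi> + 4"
| "weight (Since \<phi> a b \<psi>) = weight \<phi> + weight \<psi> + 4"
| "weight (Finally a b \<phi>) = weight \<phi> + 1"
| "weight (Globally a b \<phi>) = weight \<phi> + 3"
| "weight (Past a b \<phi>) = weight \<phi> + 1"
| "weight (Historically a b \<phi>) = weight \<phi> + 3"

function lti :: "nat \<Rightarrow> (int \<Rightarrow> 'p set) \<Rightarrow> 'p mtl \<Rightarrow> int \<Rightarrow> nat" where
  "lti T x (Atom p) i = proj x p i"
| "lti T x (Not \<phi>) i = 1 - lti T x \<phi> i"
| "lti T x (Or \<phi> \<psi>) i = max (lti T x \<phi> i) (lti T x \<psi> i)"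
| "lti T x (Until \<phi> a b \<psi>) i =
     (SUP j\<in>{a..b}. min (lti T x (Globally 1 (j - 1) \<phi>) i) (lti T x (Finally j j \<psi>) i))"
| "lti T x (Since \<phi> a b \<psi>) i =
     (SUP j\<in>{a..b}. min (lti T x (Historically 1 (j - 1) \<phi>) i) (lti T x (Past j j \<psi>) i))"
| "lti T x (Finally a b \<phi>) i = (SUP j\<in>time T. min (lti T x \<phi> j) (window_plus a b (i - j)))"
| "lti T x (Globally a b \<phi>) i = 1 - lti T x (Finally a b (Not \<phi>)) i"
| "lti T x (Past a b \<phi>) i = (SUP j\<in>time T. min (lti T x \<phi> j) (window_minus a b (i - j)))"
| "lti T x (Historically a b \<phi>) i = 1 - lti T x (Past a b (Not \<phi>)) i"
  by pat_completeness auto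
termination
  by (relation "measure (\<lambda>(T, x, \<phi>, i). weight \<phi>)") auto

definition sat_L :: "nat \<Rightarrow> (int \<Rightarrow> 'p set) \<Rightarrow> 'p mtl \<Rightarrow> int \<Rightarrow> bool" where
  "sat_L T x \<phi> i \<longleftrightarrow> lti T x \<phi> i = 1"

end

theory Submission
  imports Defs
begin

text \<open>
  On \<open>{0, 1}\<close> the operations of the max--min dioid are the Boolean ones, so the filtering value of
  a formula is the indicator of its classical truth. This is preserved by \<open>F\<close> and \<open>P\<close> because their
  windows are indicators of (reflected) intervals, and by \<open>U\<close> because classically
  \<open>\<phi> U\<^sub>I \<psi>\<close> says that \<open>G\<^bsub>[1, d - 1]\<^esub> \<phi>\<close> and \<open>F\<^bsub>[d, d]\<^esub> \<psi>\<close> hold for some \<open>d \<in> I\<close>,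
  and dually for \<open>S\<close>.
\<close>

lemma SUP_of_bool_nat: "(SUP a\<in>A. of_bool (Q a)) = (of_bool (\<exists>a\<in>A. Q a) :: nat)"
proof (cases "\<exists>a\<in>A. Q a")
  case True
  then have "(1 :: nat) \<in> (\<lambda>a. of_bool (Q a)) ` A"
    by force
  then have "(SUP a\<in>A. of_bool (Q a)) = (1 :: nat)"
    by (rule cSup_eq_maximum) auto
  with True show ?thesis
    by simp
next
  case False
  then have "(\<lambda>a. of_bool (Q a)) ` A \<subseteq> {0 :: nat}"
    by auto
  then have "(SUP a\<in>A. of_bool (Q a)) = (0 :: nat)"
    by (auto dest: subset_singletonD)
  with False show ?thesis
    by simp
qed

lemma SUP_min_of_bool_nat:
  "(SUP a\<in>A. min (of_bool (Q a)) (of_bool (R a))) = (of_bool (\<exists>a\<in>A. Q a \<and> R a) :: nat)"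
proof -
  have "min (of_bool (Q a)) (of_bool (R a)) = (of_bool (Q a \<and> R a) :: nat)" for a
    by simp
  then show ?thesis
    by (simp only: SUP_of_bool_nat)
qed

lemma window_plus_eq_of_bool: "window_plus a b t = of_bool (- t \<in> {a..b})"
proof -
  have "kdelta (t + k) = of_bool (k = - t)" for k
    by (auto simp: kdelta_def)
  then show ?thesis
    by (simp add: window_plus_def SUP_of_bool_nat)
qed

lemma window_minus_eq_window_plus: "window_minus a b t = window_plus a b (- t)"
proof -
  have "kdelta (t - k) = kdelta (- t + k)" for k
    by (simp add: kdelta_def)
  then show ?thesis
    by (simp only: window_minus_def window_plus_def)
qed

lemma bex_image_Int_split:
  assumes "\<And>d. s d \<in> A \<Longrightarrow> s ` C d \<inter> A = B (s d)"
  shows "(\<exists>j\<in>s ` D \<inter> A. R j \<and> (\<forall>k\<in>B j. Q k)) \<longleftrightarrow>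
    (\<exists>d\<in>D. (\<forall>k\<in>s ` C d \<inter> A. Q k) \<and> (\<exists>j\<in>s ` {d} \<inter> A. R j))"
  using assms by blast

text \<open>
  Classically all integers strictly between \<open>i\<close> and \<open>j\<close> matter, whereas \<open>G\<close> and \<open>H\<close> only range over
  \<open>time T\<close>; hence \<open>i \<in> time T\<close> is needed, and convexity of \<open>time T\<close> does the rest.
\<close>

lemma sat_C_Until_iff:
  assumes "i \<in> time T"
  shows "sat_C T x (Until \<phi> a b \<psi>) i \<longleftrightarrow>
    (\<exists>d\<in>{a..b}. sat_C T x (Globally 1 (d - 1) \<phi>) i \<and> sat_C T x (Finally d d \<psi>) i)"
proof -
  have "(\<lambda>k. i + k) ` {1..d - 1} \<inter> time T = {k. i < k \<and> k < i + d}"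
    if "i + d \<in> time T" for d
    using assms that by (auto simp: time_def)
  then have "(\<exists>j\<in>(\<lambda>k. i + k) ` {a..b} \<inter> time T.
        sat_C T x \<psi> j \<and> (\<forall>k\<in>{k. i < k \<and> k < j}. sat_C T x \<phi> k)) \<longleftrightarrow>
      (\<exists>d\<in>{a..b}. (\<forall>k\<in>(\<lambda>k. i + k) ` {1..d - 1} \<inter> time T. sat_C T x \<phi> k) \<and>
        (\<exists>j\<in>(\<lambda>k. i + k) ` {d} \<inter> time T. sat_C T x \<psi> j))"
    by (rule bex_image_Int_split)
  then show ?thesis
    by (simp only: sat_C.simps Ball_def mem_Collect_eq atLeastAtMost_singleton)
qed

lemma sat_C_Since_iff:
  assumes "i \<in> time T"
  shows "sat_C T x (Since \<phi> a b \<psi>) i \<longleftrightarrow>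
    (\<exists>d\<in>{a..b}. sat_C T x (Historically 1 (d - 1) \<phi>) i \<and> sat_C T x (Past d d \<psi>) i)"
proof -
  have "(\<lambda>k. i - k) ` {1..d - 1} \<inter> time T = {k. i - d < k \<and> k < i}"
    if "i - d \<in> time T" for d
    using assms that by (auto simp: time_def)
  then have "(\<exists>j\<in>(\<lambda>k. i - k) ` {a..b} \<inter> time T.
        sat_C T x \<psi> j \<and> (\<forall>k\<in>{k. j < k \<and> k < i}. sat_C T x \<phi> k)) \<longleftrightarrow>
      (\<exists>d\<in>{a..b}. (\<forall>k\<in>(\<lambda>k. i - k) ` {1..d - 1} \<inter> time T. sat_C T x \<phi> k) \<and>
        (\<exists>j\<in>(\<lambda>k. i - k) ` {d} \<inter> time T. sat_C T x \<psi> j))"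
    by (rule bex_image_Int_split)
  then show ?thesis
    by (simp only: sat_C.simps Ball_def mem_Collect_eq atLeastAtMost_singleton)
qed

definition lti_agrees :: "nat \<Rightarrow> (int \<Rightarrow> 'p set) \<Rightarrow> 'p mtl \<Rightarrow> bool" where
  "lti_agrees T x \<phi> \<longleftrightarrow> (\<forall>i\<in>time T. lti T x \<phi> i = of_bool (sat_C T x \<phi> i))"

lemma lti_agreesI:
  "(\<And>i. i \<in> time T \<Longrightarrow> lti T x \<phi> i = of_bool (sat_C T x \<phi> i)) \<Longrightarrow> lti_agrees T x \<phi>"
  by (simp add: lti_agrees_def)

lemma lti_agreesD:
  "lti_agrees T x \<phi> \<Longrightarrow> i \<in> time T \<Longrightarrow> lti T x \<phi> i = of_bool (sat_C T x \<phi> i)"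
  by (simp add: lti_agrees_def)

lemma lti_agrees_Atom: "lti_agrees T x (Atom p)"
  by (simp add: lti_agrees_def proj_def)

lemma lti_agrees_Not: "lti_agrees T x \<phi> \<Longrightarrow> lti_agrees T x (Not \<phi>)"
  by (simp add: lti_agrees_def)

lemma lti_agrees_Or: "lti_agrees T x \<phi> \<Longrightarrow> lti_agrees T x \<psi> \<Longrightarrow> lti_agrees T x (Or \<phi> \<psi>)"
  by (simp add: lti_agrees_def)

lemma SUP_min_lti_of_bool:
  assumes "lti_agrees T x \<phi>"
  shows "(SUP j\<in>time T. min (lti T x \<phi> j) (of_bool (j \<in> J))) =
    of_bool (\<exists>j\<in>J \<inter> time T. sat_C T x \<phi> j)"
proof -
  have "(SUP j\<in>time T. min (lti T x \<phi> j) (of_bool (j \<in> J))) =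
      (SUP j\<in>time T. min (of_bool (sat_C T x \<phi> j)) (of_bool (j \<in> J)))"
    by (intro SUP_cong refl) (simp only: lti_agreesD[OF assms])
  also have "\<dots> = of_bool (\<exists>j\<in>time T. sat_C T x \<phi> j \<and> j \<in> J)"
    by (rule SUP_min_of_bool_nat)
  also have "(\<exists>j\<in>time T. sat_C T x \<phi> j \<and> j \<in> J) \<longleftrightarrow> (\<exists>j\<in>J \<inter> time T. sat_C T x \<phi> j)"
    by blast
  finally show ?thesis .
qed

lemma lti_agrees_Finally:
  assumes "lti_agrees T x \<phi>"
  shows "lti_agrees T x (Finally a b \<phi>)"
proof (rule lti_agreesI)
  fix i
  have "window_plus a b (i - j) = of_bool (j \<in> (\<lambda>k. i + k) ` {a..b})" for j
    by (auto simp: window_plus_eq_of_bool)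
  then show "lti T x (Finally a b \<phi>) i = of_bool (sat_C T x (Finally a b \<phi>) i)"
    by (simp only: lti.simps sat_C.simps SUP_min_lti_of_bool[OF assms])
qed

lemma lti_agrees_Past:
  assumes "lti_agrees T x \<phi>"
  shows "lti_agrees T x (Past a b \<phi>)"
proof (rule lti_agreesI)
  fix i
  have "window_minus a b (i - j) = of_bool (j \<in> (\<lambda>k. i - k) ` {a..b})" for j
    by (auto simp: window_minus_eq_window_plus window_plus_eq_of_bool)
  then show "lti T x (Past a b \<phi>) i = of_bool (sat_C T x (Past a b \<phi>) i)"
    by (simp only: lti.simps sat_C.simps SUP_min_lti_of_bool[OF assms])
qed

lemma lti_agrees_Globally:
  assumes "lti_agrees T x \<phi>"
  shows "lti_agrees T x (Globally a b \<phi>)"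
proof -
  have "lti_agrees T x (Not (Finally a b (Not \<phi>)))"
    by (intro lti_agrees_Not lti_agrees_Finally assms)
  then show ?thesis
    by (simp add: lti_agrees_def)
qed

lemma lti_agrees_Historically:
  assumes "lti_agrees T x \<phi>"
  shows "lti_agrees T x (Historically a b \<phi>)"
proof -
  have "lti_agrees T x (Not (Past a b (Not \<phi>)))"
    by (intro lti_agrees_Not lti_agrees_Past assms)
  then show ?thesis
    by (simp add: lti_agrees_def)
qed

lemma lti_agrees_Until:
  assumes "lti_agrees T x \<phi>" and "lti_agrees T x \<psi>"
  shows "lti_agrees T x (Until \<phi> a b \<psi>)"
proof (rule lti_agreesI)
  fix i
  assume "i \<in> time T"
  then show "lti T x (Until \<phi> a b \<psi>) i = of_bool (sat_C T x (Until \<phi> a b \<psi>) i)"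
    by (simp only: lti.simps(4) sat_C_Until_iff SUP_min_of_bool_nat
        lti_agreesD[OF lti_agrees_Globally[OF assms(1)]]
        lti_agreesD[OF lti_agrees_Finally[OF assms(2)]])
qed

lemma lti_agrees_Since:
  assumes "lti_agrees T x \<phi>" and "lti_agrees T x \<psi>"
  shows "lti_agrees T x (Since \<phi> a b \<psi>)"
proof (rule lti_agreesI)
  fix i
  assume "i \<in> time T"
  then show "lti T x (Since \<phi> a b \<psi>) i = of_bool (sat_C T x (Since \<phi> a b \<psi>) i)"
    by (simp only: lti.simps(5) sat_C_Since_iff SUP_min_of_bool_nat
        lti_agreesD[OF lti_agrees_Historically[OF assms(1)]]
        lti_agreesD[OF lti_agrees_Past[OF assms(2)]])
qed

lemma lti_agrees: "lti_agrees T x \<phi>"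
  by (induction \<phi>)
    (simp_all add: lti_agrees_Atom lti_agrees_Not lti_agrees_Or lti_agrees_Until lti_agrees_Since
      lti_agrees_Finally lti_agrees_Globally lti_agrees_Past lti_agrees_Historically)

theorem theorem1:
  fixes P :: "'p set" and T :: nat and x :: "int \<Rightarrow> 'p set" and \<phi> :: "'p mtl" and i :: int
  assumes "finite P"
    and "x \<in> time T \<rightarrow> Pow P"
    and "mtl_formula P \<phi>"
    and "i \<in> time T"
  shows "sat_L T x \<phi> i \<longleftrightarrow> sat_C T x \<phi> i"
proof -
  have "lti T x \<phi> i = of_bool (sat_C T x \<phi> i)"
    using lti_agrees \<open>i \<in> time T\<close> by (rule lti_agreesD)
  then show ?thesis
    by (simp add: sat_L_def)
qed

end
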